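(* Assume linear recharge, i.e. $\varphi(\ell,\tau)=\max(0,\min(M,\ell+\alpha\tau))$ for some $\alpha>0$. Let $a=(u=s_0,s_1,\ldots,s_k,s_{k+1}=v)$ and $a'=(u=s'_0,s'_1,\ldots,s'_{k'},s'_{k'+1}=v)$ be two station sequences between $u$ and $v$ that coincide starting from one station, i.e. such that there exist $i\in\{1,\ldots,k\}$ and $i'\in\{1,\ldots,k'\}$ with $k-i=k'-i'$ and $s_{i+j}=s'_{i'+j}$ for $j\in\{0,\ldots,k-i\}$. Then $$\big(\ell^{\mathrm b,a,*}_{i}(x),t^{\mathrm b,a,*}_{i}(x)\big)\succeq\big(\ell^{\mathrm b,a',*}_{i'}(x),t^{\mathrm b,a',*}_{i'}(x)\big)\quad\text{for all }x\in[0,M]$$ if and only if $$e_{u,s_1}\le e_{u,s'_1}\quad\text{and}\quad\sum_{j=1}^{i}\big(e_{s_{j-1},s_j}+\alpha\,\delta_{s_{j-1},s_j}\big)\le\sum_{j=1}^{i'}\big(e_{s'_{j-1},s'_j}+\alpha\,\delta_{s'_{j-1},s'_j}\big).$$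
   Context: Charging. $M>0$ is the battery capacity and $\varphi(\ell,\tau)$ is the level after charging for a duration $\tau\ge0$ from level $\ell\in[0,M]$. For $\ell\le\ell'$ in $[0,M]$, $t^{\mathrm{ch}}(\ell,\ell')=\min\{\tau\ge0:\varphi(\ell,\tau)=\ell'\}$, and $t^{\mathrm{ch}}(\ell,\ell')=-t^{\mathrm{ch}}(\ell',\ell)$ if $\ell>\ell'$. Conventions: $\varphi(-\infty,\tau)=-\infty$ and $t^{\mathrm{ch}}(-\infty,\ell')=0$. Station sequences. There are sets $\mathcal T$ (services), $\mathcal D$ (depots), $\mathcal S$ (charging stations), and a horizon $[0,t_{\max}]$. Each service $w$ has a fixed begin time $t^{\mathrm b}_w$ and end time $t^{\mathrm e}_w$; for a depot $w$, $t^{\mathrm b}_w=t_{\max}$ and $t^{\mathrm e}_w=0$. $\delta_{w,w'}\ge 0$ and $e_{w,w'}\ge0$ are the travel time and energy needed to go from $w$ to $w'$; $e_w\ge0$ is the energy consumed by service $w$, with $e_w=0$ for depots and stations. For $u,v\in\mathcal D\cup\mathcal T$, a station sequence $a$ between $u$ and $v$ is a sequence $u=s_0,s_1,\ldots,s_k,s_{k+1}=v$ with $s_1,\ldots,s_k\in\mathcal S$ such that $t^{\mathrm e}_u+\sum_{i=1}^{k+1}\delta_{s_{i-1},s_i}\le t^{\mathrm b}_v$, $e_u+e_{u,s_1}\le M$, $e_{s_{i-1},s_i}\le M$ for $1\le i\le k$, and $e_{s_k,v}+e_v\le M$. Schedule $\mathbf t^{a,*}(x)$ and its levels. Let $\mathrm{pos}(z)=z$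 if $z\ge0$ and $-\infty$ otherwise. For an initial level $x$ at the end of $u$, the arrival and departure times $t^{\mathrm b,a,*}_i(x),t^{\mathrm e,a,*}_i(x)$ at $s_i$ and the charge levels $\ell^{\mathrm b,a,*}_i(x)$ (on arrival at $s_i$) and $\ell^{\mathrm e,a,*}_i(x)$ (on departure from $s_i$) are defined recursively by $t^{\mathrm e,a,*}_0=t^{\mathrm e}_u$, $\ell^{\mathrm e,a,*}_0=x$; for $1\le i\le k$, $t^{\mathrm b,a,*}_i=t^{\mathrm e,a,*}_{i-1}+\delta_{s_{i-1},s_i}$ and $\ell^{\mathrm b,a,*}_i=\mathrm{pos}(\ell^{\mathrm e,a,*}_{i-1}-e_{s_{i-1},s_i})$; for $1\le i\le k-1$, $t^{\mathrm e,a,*}_i=t^{\mathrm b,a,*}_i$ if $\ell^{\mathrm b,a,*}_i\ge e_{s_i,s_{i+1}}$ and $t^{\mathrm e,a,*}_i=t^{\mathrm b,a,*}_i+t^{\mathrm{ch}}(\ell^{\mathrm b,a,*}_i,e_{s_i,s_{i+1}})$ otherwise; $t^{\mathrm e,a,*}_k=t^{\mathrm b}_v-\delta_{s_k,v}$; and, for $1\le i\le k$, $\ell^{\mathrm e,a,*}_i=\varphi(\ell^{\mathrm b,a,*}_i,t^{\mathrm e,a,*}_i-t^{\mathrm b,a,*}_i)$ if $t^{\mathrm e,a,*}_i\ge t^{\mathrm b,a,*}_i$ and $-\infty$ otherwise. Order. On $S=([0,M]\cup\{-\infty\})\times\mathbb R$, the relation $\preceq$ is defined by: $(-\infty,t)\preceq(\ell',t')$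 always; $(\ell,t)\preceq(-\infty,t')$ iff $\ell=-\infty$; and for $\ell,\ell'\in[0,M]$, $(\ell,t)\preceq(\ell',t')$ iff $t+t^{\mathrm{ch}}(\ell,\ell')\ge t'$. $p\succeq q$ means $q\preceq p$. *)

theory Defs
  imports "HOL-Library.Extended_Real"
begin

text \<open>
  Levels are extended reals: \<open>-\<infinity>\<close> encodes an infeasible level, and \<open>\<infinity>\<close> is never used.
  The functions \<open>begin_time\<close>, \<open>end_time\<close>, \<open>consumption\<close>, \<open>travel_time\<close>, \<open>travel_energy\<close>
  are only meaningful on \<open>services \<union> depots \<union> stations\<close>, and \<open>charge l \<tau>\<close>
  only for \<open>0 \<le> l \<le> capacity\<close> and \<open>0 \<le> \<tau>\<close>.
\<close>

record 'w network =
  capacity :: real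
  charge :: "real \<Rightarrow> real \<Rightarrow> real"
  services :: "'w set"
  depots :: "'w set"
  stations :: "'w set"
  horizon :: real
  begin_time :: "'w \<Rightarrow> real"
  end_time :: "'w \<Rightarrow> real"
  consumption :: "'w \<Rightarrow> real"
  travel_time :: "'w \<Rightarrow> 'w \<Rightarrow> real"
  travel_energy :: "'w \<Rightarrow> 'w \<Rightarrow> real"

locale charging_network =
  fixes N :: "'w network"
  assumes capacity_pos: "capacity N > 0"
    and horizon_nonneg: "horizon N \<ge> 0"
    and depot_begin: "w \<in> depots N \<Longrightarrow> begin_time N w = horizon N"
    and depot_end: "w \<in> depots N \<Longrightarrow> end_time N w = 0"
    and service_consumption: "w \<in> services N \<Longrightarrow> consumption N w \<ge> 0"
    and other_consumption: "w \<in> depots N \<union> stations N \<Longrightarrow> consumption N w = 0"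
    and travel_time_nonneg:
      "\<lbrakk>w \<in> services N \<union> depots N \<union> stations N; w' \<in> services N \<union> depots N \<union> stations N\<rbrakk>
        \<Longrightarrow> travel_time N w w' \<ge> 0"
    and travel_energy_nonneg:
      "\<lbrakk>w \<in> services N \<union> depots N \<union> stations N; w' \<in> services N \<union> depots N \<union> stations N\<rbrakk>
        \<Longrightarrow> travel_energy N w w' \<ge> 0"

definition linear_recharge :: "'w network \<Rightarrow> real \<Rightarrow> bool" where
  "linear_recharge N \<alpha> \<longleftrightarrow>
     (\<forall>l \<in> {0..capacity N}. \<forall>\<tau> \<ge> 0. charge N l \<tau> = max 0 (min (capacity N) (l + \<alpha> * \<tau>)))"

definition charge_ext :: "'w network \<Rightarrow> ereal \<Rightarrow> real \<Rightarrow> ereal" where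
  "charge_ext N l \<tau> = (if l = -\<infinity> then -\<infinity> else ereal (charge N (real_of_ereal l) \<tau>))"

definition charging_time :: "'w network \<Rightarrow> real \<Rightarrow> real \<Rightarrow> real" where
  "charging_time N l l' =
     (if l \<le> l' then (LEAST \<tau>. \<tau> \<ge> 0 \<and> charge N l \<tau> = l')
      else - (LEAST \<tau>. \<tau> \<ge> 0 \<and> charge N l' \<tau> = l))"

definition charging_time_ext :: "'w network \<Rightarrow> ereal \<Rightarrow> real \<Rightarrow> real" where
  "charging_time_ext N l l' = (if l = -\<infinity> then 0 else charging_time N (real_of_ereal l) l')"

definition level_time_le :: "'w network \<Rightarrow> ereal \<times> real \<Rightarrow> ereal \<times> real \<Rightarrow> bool" where
  "level_time_le N p q \<longleftrightarrow>
     (case (p, q) of ((l, t), (l', t')) \<Rightarrow>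
       if l = -\<infinity> then True
       else if l' = -\<infinity> then False
       else t + charging_time N (real_of_ereal l) (real_of_ereal l') \<ge> t')"

definition pos :: "ereal \<Rightarrow> ereal" where
  "pos z = (if z \<ge> 0 then z else -\<infinity>)"

text \<open>
  The sequence \<open>s\<^sub>0, \<dots>, s\<^bsub>k+1\<^esub>\<close> is given by its number \<open>k\<close> of stations and a function
  on the naturals whose values beyond \<open>k + 1\<close> are irrelevant.
\<close>

definition station_sequence :: "'w network \<Rightarrow> 'w \<Rightarrow> 'w \<Rightarrow> nat \<Rightarrow> (nat \<Rightarrow> 'w) \<Rightarrow> bool" where
  "station_sequence N u v k s \<longleftrightarrow>
     u \<in> depots N \<union> services N \<and> v \<in> depots N \<union> services N \<and>
     s 0 = u \<and> s (k + 1) = v \<and> (\<forall>i \<in> {1..k}. s i \<in> stations N) \<and>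
     end_time N u + (\<Sum>i = 1..k + 1. travel_time N (s (i - 1)) (s i)) \<le> begin_time N v \<and>
     consumption N u + travel_energy N u (s 1) \<le> capacity N \<and>
     (\<forall>i \<in> {1..k}. travel_energy N (s (i - 1)) (s i) \<le> capacity N) \<and>
     travel_energy N (s k) v + consumption N v \<le> capacity N"

text \<open>
  Arrival is unspecified at index \<open>0\<close>, and values at indices above \<open>k\<close> carry no meaning.
\<close>

function (sequential) arr_time :: "'w network \<Rightarrow> nat \<Rightarrow> (nat \<Rightarrow> 'w) \<Rightarrow> real \<Rightarrow> nat \<Rightarrow> real"
  and arr_level :: "'w network \<Rightarrow> nat \<Rightarrow> (nat \<Rightarrow> 'w) \<Rightarrow> real \<Rightarrow> nat \<Rightarrow> ereal"
  and dep_time :: "'w network \<Rightarrow> nat \<Rightarrow> (nat \<Rightarrow> 'w) \<Rightarrow> real \<Rightarrow> nat \<Rightarrow> real"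
  and dep_level :: "'w network \<Rightarrow> nat \<Rightarrow> (nat \<Rightarrow> 'w) \<Rightarrow> real \<Rightarrow> nat \<Rightarrow> ereal"
where
  "arr_time N k s x (Suc i) = dep_time N k s x i + travel_time N (s i) (s (Suc i))"
| "arr_level N k s x (Suc i) = pos (dep_level N k s x i - ereal (travel_energy N (s i) (s (Suc i))))"
| "dep_time N k s x 0 = end_time N (s 0)"
| "dep_time N k s x (Suc i) =
     (if Suc i = k then begin_time N (s (k + 1)) - travel_time N (s k) (s (k + 1))
      else if arr_level N k s x (Suc i) \<ge> ereal (travel_energy N (s (Suc i)) (s (Suc (Suc i))))
      then arr_time N k s x (Suc i)
      else arr_time N k s x (Suc i) +
        charging_time_ext N (arr_level N k s x (Suc i)) (travel_energy N (s (Suc i)) (s (Suc (Suc i)))))"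
| "dep_level N k s x 0 = ereal x"
| "dep_level N k s x (Suc i) =
     (if dep_time N k s x (Suc i) \<ge> arr_time N k s x (Suc i)
      then charge_ext N (arr_level N k s x (Suc i)) (dep_time N k s x (Suc i) - arr_time N k s x (Suc i))
      else -\<infinity>)"
  by pat_completeness auto
termination
  by (relation "measure (case_sum
        (case_sum (\<lambda>(_, _, _, _, i). 4 * i) (\<lambda>(_, _, _, _, i). 4 * i))
        (case_sum (\<lambda>(_, _, _, _, i). 4 * i + 1) (\<lambda>(_, _, _, _, i). 4 * i + 2)))") auto

end

theory Submission
  imports Defs
begin

text \<open>
  If the initial level does not suffice to reach the first station, the level is \<open>-\<infinity>\<close> forever.
  Otherwise the schedule never runs empty before the last station, and with linear recharge the
  quantity \<open>\<alpha> t - \<ell>\<close> is unchanged by charging while each leg raises it by \<open>e + \<alpha> \<delta>\<close>. Two finite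
  pairs are ordered by comparing \<open>\<alpha> t - \<ell>\<close>, so for every feasible \<open>x\<close> the comparison amounts to that
  of the sums, independently of \<open>x\<close>; the levels \<open>x = M\<close> and \<open>x = e\<^bsub>u,s'\<^sub>1\<^esub>\<close> give necessity.
\<close>

lemma station_sequence_leg_energy:
  assumes "charging_network N" "station_sequence N u v k s" "j \<in> {1..k}"
  shows "0 \<le> travel_energy N (s (j - 1)) (s j)" "travel_energy N (s (j - 1)) (s j) \<le> capacity N"
proof -
  have "s (j - 1) \<in> services N \<union> depots N \<union> stations N"
    using assms(2,3) by (cases "j = 1") (force simp: station_sequence_def)+
  moreover have "s j \<in> services N \<union> depots N \<union> stations N"
    using assms(2,3) by (auto simp: station_sequence_def)
  ultimately show "0 \<le> travel_energy N (s (j - 1)) (s j)"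
    by (rule charging_network.travel_energy_nonneg[OF assms(1)])
  show "travel_energy N (s (j - 1)) (s j) \<le> capacity N"
    using assms(2,3) by (auto simp: station_sequence_def)
qed

lemma linear_recharge_charge:
  assumes "\<alpha> > 0" "linear_recharge N \<alpha>" "0 \<le> l" "l \<le> l'" "l' \<le> capacity N"
  shows "charge N l ((l' - l) / \<alpha>) = l'"
  using assms by (simp add: linear_recharge_def)

text \<open>Between two levels in \<open>{0..capacity N}\<close> the clamping is inactive until the
  target is reached, so the first hitting time is that of the line
  \<open>l + \<alpha> * \<tau>\<close>. The sign convention for decreasing levels extends the same
  formula to both orders.\<close>

lemma linear_recharge_charging_time:
  assumes "\<alpha> > 0" "linear_recharge N \<alpha>" "l \<in> {0..capacity N}" "l' \<in> {0..capacity N}"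
  shows "charging_time N l l' = (l' - l) / \<alpha>"
proof -
  have "(LEAST \<tau>. \<tau> \<ge> 0 \<and> charge N a \<tau> = b) = (b - a) / \<alpha>"
    if "0 \<le> a" "a \<le> b" "b \<le> capacity N" for a b
  proof (rule Least_equality)
    show "(b - a) / \<alpha> \<ge> 0 \<and> charge N a ((b - a) / \<alpha>) = b"
      using that assms(1) linear_recharge_charge[OF assms(1,2) that] by simp
  next
    fix \<tau> assume \<tau>: "\<tau> \<ge> 0 \<and> charge N a \<tau> = b"
    then have "\<tau> \<ge> 0" ..
    then have "charge N a \<tau> = max 0 (min (capacity N) (a + \<alpha> * \<tau>))"
      using that assms(2) by (simp add: linear_recharge_def)
    moreover have "0 \<le> a + \<alpha> * \<tau>"
      using that \<tau> assms(1) by simp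
    \<comment> \<open>If \<open>b\<close> is the capacity, the level stays at \<open>b\<close> at
      all later times, so only an inequality is available; it is what minimality asks for.\<close>
    ultimately have "b - a \<le> \<alpha> * \<tau>"
      using \<tau> by linarith
    then show "(b - a) / \<alpha> \<le> \<tau>"
      using assms(1) by (simp add: divide_le_eq mult.commute)
  qed
  from this[of l l'] this[of l' l] show ?thesis
    using assms by (auto simp: charging_time_def minus_divide_left)
qed

lemma level_time_le_linear:
  assumes "\<alpha> > 0" "linear_recharge N \<alpha>" "l \<in> {0..capacity N}" "l' \<in> {0..capacity N}"
  shows "level_time_le N (ereal l, t) (ereal l', t') \<longleftrightarrow> \<alpha> * t' - l' \<le> \<alpha> * t - l"
proof -
  have "level_time_le N (ereal l, t) (ereal l', t') \<longleftrightarrow> t' \<le> t + (l' - l) / \<alpha>"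
    by (simp add: level_time_le_def linear_recharge_charging_time[OF assms])
  also have "\<dots> \<longleftrightarrow> \<alpha> * t' - l' \<le> \<alpha> * t - l"
    using assms(1) by (simp add: field_simps)
  finally show ?thesis .
qed

text \<open>The level \<open>-\<infinity>\<close> is absorbing: charging and travelling both
  preserve it, whatever the departure time, so failure on the first leg settles all later
  arrivals.\<close>

lemma arr_level_infeasible:
  assumes "x < travel_energy N (s 0) (s 1)"
  shows "arr_level N k s x (Suc n) = -\<infinity>"
proof (induction n)
  case 0
  then show ?case using assms by (simp add: pos_def)
next
  case (Suc n)
  then have "dep_level N k s x (Suc n) = -\<infinity>"
    by (auto simp: charge_ext_def)
  then show ?case by (simp add: pos_def)
qed

lemma arr_feasible:
  assumes "charging_network N" "\<alpha> > 0" "linear_recharge N \<alpha>" "station_sequence N u v k s"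
    and "x \<le> capacity N" "travel_energy N (s 0) (s 1) \<le> x" "Suc n \<le> k"
  shows "\<exists>l \<in> {0..capacity N}. arr_level N k s x (Suc n) = ereal l \<and>
    \<alpha> * arr_time N k s x (Suc n) - l = \<alpha> * end_time N (s 0) - x +
      (\<Sum>j = 1..Suc n. travel_energy N (s (j - 1)) (s j) + \<alpha> * travel_time N (s (j - 1)) (s j))"
  using assms(7)
proof (induction n)
  case 0
  then show ?case
    using station_sequence_leg_energy[OF assms(1,4), of 1] assms(5,6)
    by (intro bexI[of _ "x - travel_energy N (s 0) (s 1)"]) (auto simp: pos_def algebra_simps)
next
  case (Suc n)
  let ?e = "travel_energy N (s (Suc n)) (s (Suc (Suc n)))"
  let ?arr = "arr_time N k s x (Suc n)" and ?dep = "dep_time N k s x (Suc n)"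
  obtain l where l: "0 \<le> l" "l \<le> capacity N" "arr_level N k s x (Suc n) = ereal l"
    and potential: "\<alpha> * ?arr - l = \<alpha> * end_time N (s 0) - x +
      (\<Sum>j = 1..Suc n. travel_energy N (s (j - 1)) (s j) + \<alpha> * travel_time N (s (j - 1)) (s j))"
    using Suc by fastforce
  have e: "0 \<le> ?e" "?e \<le> capacity N"
    using station_sequence_leg_energy[OF assms(1,4), of "Suc (Suc n)"] Suc.prems by auto
  \<comment> \<open>Since \<open>Suc (Suc n) \<le> k\<close>, this is not the last station, so the
    charge covers exactly the shortfall for the next leg, with duration zero if there is
    none.\<close>
  have dep: "?dep = ?arr + (max l ?e - l) / \<alpha>"
    using Suc.prems l e linear_recharge_charging_time[OF assms(2,3), of l ?e]
    by (auto simp: charging_time_ext_def max_def simp del: arr_time.simps arr_level.simps)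
  \<comment> \<open>The charging duration is nonnegative, which excludes the
    \<open>-\<infinity>\<close> branch.\<close>
  have "dep_level N k s x (Suc n) = ereal (charge N l ((max l ?e - l) / \<alpha>))"
    using l assms(2) by (simp add: dep charge_ext_def del: arr_time.simps arr_level.simps dep_time.simps)
  also have "charge N l ((max l ?e - l) / \<alpha>) = max l ?e"
    using l e by (intro linear_recharge_charge[OF assms(2,3)]) auto
  \<comment> \<open>Departing with at least \<open>?e\<close> keeps the next level nonnegative, so
    \<open>pos\<close> leaves it unchanged.\<close>
  finally have level: "arr_level N k s x (Suc (Suc n)) = ereal (max l ?e - ?e)"
    by (simp add: pos_def del: dep_level.simps ereal_max)
  have "arr_time N k s x (Suc (Suc n)) = ?dep + travel_time N (s (Suc n)) (s (Suc (Suc n)))"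
    by (rule arr_time.simps)
  \<comment> \<open>Multiplied by \<open>\<alpha>\<close>, the charging duration equals the gain in
    level; the two cancel and only the contribution of the leg remains.\<close>
  then have "\<alpha> * arr_time N k s x (Suc (Suc n)) - (max l ?e - ?e) =
      \<alpha> * ?arr - l + (?e + \<alpha> * travel_time N (s (Suc n)) (s (Suc (Suc n))))"
    unfolding dep using assms(2) by (simp add: distrib_left del: arr_time.simps)
  then show ?case
    using l e level potential
    by (intro bexI[of _ "max l ?e - ?e"])
      (auto simp del: arr_time.simps arr_level.simps)
qed

theorem corollary1:
  fixes N :: "'w network" and \<alpha> :: real and u v :: 'w
    and k k' i i' :: nat and s s' :: "nat \<Rightarrow> 'w"
  assumes "charging_network N"
    and "\<alpha> > 0" and "linear_recharge N \<alpha>"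
    and "station_sequence N u v k s"
    and "station_sequence N u v k' s'"
    and "i \<in> {1..k}" and "i' \<in> {1..k'}" and "k - i = k' - i'"
    and "\<forall>j \<in> {0..k - i}. s (i + j) = s' (i' + j)"
  shows "(\<forall>x \<in> {0..capacity N}.
            level_time_le N
              (arr_level N k' s' x i', arr_time N k' s' x i')
              (arr_level N k s x i, arr_time N k s x i)) \<longleftrightarrow>
         travel_energy N u (s 1) \<le> travel_energy N u (s' 1) \<and>
         (\<Sum>j = 1..i. travel_energy N (s (j - 1)) (s j) + \<alpha> * travel_time N (s (j - 1)) (s j))
           \<le> (\<Sum>j = 1..i'. travel_energy N (s' (j - 1)) (s' j) + \<alpha> * travel_time N (s' (j - 1)) (s' j))"
proof -
  let ?M = "capacity N"
  let ?e = "travel_energy N u (s 1)" and ?e' = "travel_energy N u (s' 1)"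
  let ?arr = "\<lambda>x. (arr_level N k s x i, arr_time N k s x i)"
  let ?arr' = "\<lambda>x. (arr_level N k' s' x i', arr_time N k' s' x i')"
  let ?sum = "\<lambda>s n. \<Sum>j = 1..n. travel_energy N (s (j - 1)) (s j) + \<alpha> * travel_time N (s (j - 1)) (s j)"
  obtain n n' where n: "i = Suc n" "i' = Suc n'" "Suc n \<le> k" "Suc n' \<le> k'"
    using assms(6,7) by (metis Suc_le_D atLeastAtMost_iff One_nat_def)
  have u: "s 0 = u" "s' 0 = u"
    using assms(4,5) by (auto simp: station_sequence_def)
  have e: "0 \<le> ?e'" "?e \<le> ?M" "?e' \<le> ?M"
    using station_sequence_leg_energy[OF assms(1,4), of 1] station_sequence_leg_energy[OF assms(1,5), of 1] n u
    by auto
  have infeasible: "arr_level N k s x i = -\<infinity>" if "x < ?e" for x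
    unfolding n using that u by (intro arr_level_infeasible) simp
  have infeasible': "arr_level N k' s' x i' = -\<infinity>" if "x < ?e'" for x
    unfolding n using that u by (intro arr_level_infeasible) simp
  \<comment> \<open>Both schedules start from the same end time and the same level, so the terms in
    \<open>end_time N u\<close> and \<open>x\<close> cancel.\<close>
  have compare: "level_time_le N (?arr' x) (?arr x) \<longleftrightarrow> ?sum s i \<le> ?sum s' i'"
    if x: "?e \<le> x" "?e' \<le> x" "x \<le> ?M" for x
  proof -
    obtain l where l: "l \<in> {0..?M}" "arr_level N k s x i = ereal l"
      "\<alpha> * arr_time N k s x i - l = \<alpha> * end_time N u - x + ?sum s i"
      using arr_feasible[OF assms(1-4) x(3) _ n(3)] x(1) unfolding n(1) u by blast
    obtain l' where l': "l' \<in> {0..?M}" "arr_level N k' s' x i' = ereal l'"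
      "\<alpha> * arr_time N k' s' x i' - l' = \<alpha> * end_time N u - x + ?sum s' i'"
      using arr_feasible[OF assms(1-3,5) x(3) _ n(4)] x(2) unfolding n(2) u by blast
    show ?thesis
      unfolding l(2) l'(2) level_time_le_linear[OF assms(2,3) l'(1) l(1)] l(3) l'(3) by simp
  qed
  show ?thesis
  proof (intro iffI conjI ballI)
    assume le: "\<forall>x \<in> {0..?M}. level_time_le N (?arr' x) (?arr x)"
    \<comment> \<open>The level \<open>?e'\<close> just suffices for the first leg of
      \<open>s'\<close>. If \<open>?e\<close> were larger, \<open>s\<close> would fail there, and a
      finite pair is never below one at \<open>-\<infinity>\<close>.\<close>
    show "?e \<le> ?e'"
    proof (rule ccontr)
      assume "\<not> ?e \<le> ?e'"
      moreover obtain l' where "arr_level N k' s' ?e' i' = ereal l'"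
        using arr_feasible[OF assms(1-3,5) e(3) _ n(4)] unfolding n(2) u by blast
      moreover have "level_time_le N (?arr' ?e') (?arr ?e')"
        using le e by simp
      ultimately show False
        using infeasible[of ?e'] by (simp add: level_time_le_def)
    qed
    \<comment> \<open>A full battery reaches the first station of both sequences.\<close>
    show "?sum s i \<le> ?sum s' i'"
      using le compare[of ?M] e by simp
  next
    fix x
    assume "?e \<le> ?e' \<and> ?sum s i \<le> ?sum s' i'" and "x \<in> {0..?M}"
    \<comment> \<open>Below \<open>?e'\<close> the left pair is at \<open>-\<infinity>\<close>,
      hence below everything; from \<open>?e'\<close> on, \<open>x\<close> also covers
      \<open>?e\<close>, so both schedules are feasible.\<close>
    then show "level_time_le N (?arr' x) (?arr x)"
      using infeasible'[of x] compare[of x] by (cases "x < ?e'") (auto simp: level_time_le_def)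
  qed
qed

end
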